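(* Let $n\ge3$, let $\lambda\in\mathbb{C}$ with $\lambda\ne2n-3$ and $\lambda\neq\frac{5-2n}{2}$, and let $(\mathfrak{r}_{2n+1}(\lambda),\cdot,[-,-])$ be a non-trivial transposed Poisson algebra structure on the Lie algebra $\mathfrak{r}_{2n+1}(\lambda)$. Then, up to isomorphism, the multiplication $\cdot$ has one of the following forms, where products of basis elements that are not listed (up to commutativity) are zero: $\mathbf{TP}_1(\mathfrak{r}_{2n+1}(\lambda))$: $x\cdot x=e_{2n}$; $\mathbf{TP}_2(\mathfrak{r}_{2n+1}(\lambda))$: $e_2\cdot x=e_{2n}$, $x\cdot x=(3-2n)e_{2n-1}$; $\mathbf{TP}_3(\mathfrak{r}_{2n+1}(\frac{3-2n}{2}))$ (only when $\lambda=\frac{3-2n}{2}$): $e_2\cdot x=e_{2n}$, $x\cdot x=(3-2n)e_{2n-1}+e_{2n}$.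
   Context: All algebras are over $\mathbb{C}$. A transposed Poisson algebra is a vector space $\mathfrak{L}$ with bilinear operations $\cdot$ and $[-,-]$ such that $(\mathfrak{L},\cdot)$ is a commutative associative algebra, $(\mathfrak{L},[-,-])$ is a Lie algebra, and $2z\cdot[u,v]=[z\cdot u,v]+[u,z\cdot v]$ for all $u,v,z\in\mathfrak{L}$. A transposed Poisson structure on a Lie algebra $(\mathfrak{L},[-,-])$ is an operation $\cdot$ making $(\mathfrak{L},\cdot,[-,-])$ a transposed Poisson algebra; it is trivial if $u\cdot v=0$ for all $u,v$. An isomorphism of transposed Poisson algebras is a linear bijection preserving both operations (so two structures on the same Lie algebra are isomorphic iff some Lie algebra automorphism carries one product to the other). $\mathfrak{r}_{2n+1}(\lambda)$ is the $(2n+1)$-dimensional Lie algebra with basis $e_1,\dots,e_{2n},x$ and brackets $[e_i,e_1]=e_{i+1}$ for $2\le i\le 2n-2$; $[e_i,e_{2n+1-i}]=(-1)^ie_{2n}$ for $2\le i\le n$; $[e_1,x]=e_1$; $[e_i,x]=(i-2+\lambda)e_i$ for $2\le i\le 2n-1$; $[e_{2n},x]=(2n-3+2\lambda)e_{2n}$; brackets of basis elements not determined by these and antisymmetry are zero. *)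

theory Defs
  imports Complex_Main
begin

definition bilinear_op ::
  "(complex \<Rightarrow> 'a::ab_group_add \<Rightarrow> 'a) \<Rightarrow> ('a \<Rightarrow> 'a \<Rightarrow> 'a) \<Rightarrow> bool" where
  "bilinear_op scale f \<longleftrightarrow>
     (\<forall>u. Vector_Spaces.linear scale scale (\<lambda>v. f u v)) \<and>
     (\<forall>v. Vector_Spaces.linear scale scale (\<lambda>u. f u v))"

locale complex_lie_algebra = vector_space scale
  for scale :: "complex \<Rightarrow> 'a::ab_group_add \<Rightarrow> 'a" +
  fixes br :: "'a \<Rightarrow> 'a \<Rightarrow> 'a"
  assumes br_bilinear: "bilinear_op scale br"
    and br_alternating: "br u u = 0"
    and br_jacobi: "br u (br v w) + br v (br w u) + br w (br u v) = 0"

locale transposed_poisson_algebra = complex_lie_algebra scale br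
  for scale :: "complex \<Rightarrow> 'a::ab_group_add \<Rightarrow> 'a" and br :: "'a \<Rightarrow> 'a \<Rightarrow> 'a" +
  fixes mul :: "'a \<Rightarrow> 'a \<Rightarrow> 'a"
  assumes mul_bilinear: "bilinear_op scale mul"
    and mul_commute: "mul u v = mul v u"
    and mul_assoc: "mul (mul u v) w = mul u (mul v w)"
    and transposed_leibniz:
      "scale 2 (mul z (br u v)) = br (mul z u) v + br u (mul z v)"

definition trivial_product :: "('a \<Rightarrow> 'a \<Rightarrow> 'a::zero) \<Rightarrow> bool" where
  "trivial_product mul \<longleftrightarrow> (\<forall>u v. mul u v = 0)"

definition tp_isomorphic ::
  "(complex \<Rightarrow> 'a::ab_group_add \<Rightarrow> 'a) \<Rightarrow> ('a \<Rightarrow> 'a \<Rightarrow> 'a) \<Rightarrow> ('a \<Rightarrow> 'a \<Rightarrow> 'a) \<Rightarrow>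
   (complex \<Rightarrow> 'b::ab_group_add \<Rightarrow> 'b) \<Rightarrow> ('b \<Rightarrow> 'b \<Rightarrow> 'b) \<Rightarrow> ('b \<Rightarrow> 'b \<Rightarrow> 'b) \<Rightarrow> bool" where
  "tp_isomorphic scale br mul scale' br' mul' \<longleftrightarrow>
     (\<exists>\<phi>. Vector_Spaces.linear scale scale' \<phi> \<and> bij \<phi> \<and>
          (\<forall>u v. \<phi> (br u v) = br' (\<phi> u) (\<phi> v)) \<and>
          (\<forall>u v. \<phi> (mul u v) = mul' (\<phi> u) (\<phi> v)))"

definition r_basis :: "nat \<Rightarrow> (nat \<Rightarrow> 'a) \<Rightarrow> 'a \<Rightarrow> 'a set" where
  "r_basis n e x = insert x (e ` {1..2*n})"

text \<open>The pairs \<open>(i, j)\<close> for which \<open>[e\<^sub>i, e\<^sub>j]\<close> is prescribed in the multiplication table of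
  \<open>r\<^sub>2\<^sub>n\<^sub>+\<^sub>1(\<lambda>)\<close>; the pairs \<open>(j, i)\<close> are then determined by antisymmetry.\<close>

definition r_listed :: "nat \<Rightarrow> nat \<Rightarrow> nat \<Rightarrow> bool" where
  "r_listed n i j \<longleftrightarrow>
     (2 \<le> i \<and> i \<le> 2*n - 2 \<and> j = 1) \<or> (2 \<le> i \<and> i \<le> n \<and> j = 2*n + 1 - i)"

text \<open>The Lie algebra \<open>r\<^sub>2\<^sub>n\<^sub>+\<^sub>1(\<lambda>)\<close>, carried by the whole type \<open>'a\<close>. Only the values
  \<open>e 1, \<dots>, e (2*n)\<close> of the sequence \<open>e\<close> matter.\<close>

locale r_lie_algebra = complex_lie_algebra scale br
  for scale :: "complex \<Rightarrow> 'a::ab_group_add \<Rightarrow> 'a" and br :: "'a \<Rightarrow> 'a \<Rightarrow> 'a" +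
  fixes n :: nat and lam :: complex and e :: "nat \<Rightarrow> 'a" and x :: 'a
  assumes e_inj: "inj_on e {1..2*n}"
    and x_notin: "x \<notin> e ` {1..2*n}"
    and basis_independent: "independent (r_basis n e x)"
    and basis_span: "span (r_basis n e x) = UNIV"
    and br_e_e1: "\<lbrakk>2 \<le> i; i \<le> 2*n - 2\<rbrakk> \<Longrightarrow> br (e i) (e 1) = e (i + 1)"
    and br_e_e: "\<lbrakk>2 \<le> i; i \<le> n\<rbrakk> \<Longrightarrow> br (e i) (e (2*n + 1 - i)) = scale ((-1) ^ i) (e (2*n))"
    and br_e_e_zero: "\<lbrakk>i \<in> {1..2*n}; j \<in> {1..2*n}; \<not> r_listed n i j; \<not> r_listed n j i\<rbrakk>
                      \<Longrightarrow> br (e i) (e j) = 0"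
    and br_e1_x: "br (e 1) x = e 1"
    and br_e_x: "\<lbrakk>2 \<le> i; i \<le> 2*n - 1\<rbrakk> \<Longrightarrow> br (e i) x = scale (of_nat i - 2 + lam) (e i)"
    and br_e2n_x: "br (e (2*n)) x = scale (2 * of_nat n - 3 + 2 * lam) (e (2*n))"

text \<open>The three multiplication tables. The condition \<open>{u, v} = {e 2, x}\<close> covers both orders
  of the factors.\<close>

definition TP1 :: "nat \<Rightarrow> (nat \<Rightarrow> 'a::ab_group_add) \<Rightarrow> 'a \<Rightarrow> ('a \<Rightarrow> 'a \<Rightarrow> 'a) \<Rightarrow> bool" where
  "TP1 n e x mul \<longleftrightarrow>
     (\<forall>u\<in>r_basis n e x. \<forall>v\<in>r_basis n e x. mul u v =
        (if u = x \<and> v = x then e (2*n) else 0))"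

definition TP2 :: "(complex \<Rightarrow> 'a \<Rightarrow> 'a) \<Rightarrow> nat \<Rightarrow> (nat \<Rightarrow> 'a::ab_group_add) \<Rightarrow> 'a \<Rightarrow>
    ('a \<Rightarrow> 'a \<Rightarrow> 'a) \<Rightarrow> bool" where
  "TP2 scale n e x mul \<longleftrightarrow>
     (\<forall>u\<in>r_basis n e x. \<forall>v\<in>r_basis n e x. mul u v =
        (if {u, v} = {e 2, x} then e (2*n)
         else if u = x \<and> v = x then scale (3 - 2 * of_nat n) (e (2*n - 1))
         else 0))"

definition TP3 :: "(complex \<Rightarrow> 'a \<Rightarrow> 'a) \<Rightarrow> nat \<Rightarrow> (nat \<Rightarrow> 'a::ab_group_add) \<Rightarrow> 'a \<Rightarrow>
    ('a \<Rightarrow> 'a \<Rightarrow> 'a) \<Rightarrow> bool" where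
  "TP3 scale n e x mul \<longleftrightarrow>
     (\<forall>u\<in>r_basis n e x. \<forall>v\<in>r_basis n e x. mul u v =
        (if {u, v} = {e 2, x} then e (2*n)
         else if u = x \<and> v = x then scale (3 - 2 * of_nat n) (e (2*n - 1)) + e (2*n)
         else 0))"

end

theory Submission
  imports Defs
begin

text \<open>Multiplication by a fixed element of a transposed Poisson algebra is a half-derivation
  \<open>\<phi>\<close> of the Lie algebra, \<open>2 \<phi>[u,v] = [\<phi> u,v] + [u,\<phi> v]\<close>. Comparing coordinates in this identity shows
  that \<open>\<phi>\<close> is a scalar \<open>\<xi>\<close> plus the map \<open>e\<^sub>2 \<mapsto> b e\<^sub>2\<^sub>n\<close>, \<open>x \<mapsto> (3-2n) b e\<^sub>2\<^sub>n\<^sub>-\<^sub>1 + a e\<^sub>2\<^sub>n\<close>.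
  Commutativity then kills all scalars and leaves only the products \<open>e\<^sub>2 \<cdot> x = b e\<^sub>2\<^sub>n\<close> and
  \<open>x \<cdot> x = (3-2n) b e\<^sub>2\<^sub>n\<^sub>-\<^sub>1 + a e\<^sub>2\<^sub>n\<close>. The diagonal automorphisms
  \<open>e\<^sub>1 \<mapsto> s e\<^sub>1\<close>, \<open>e\<^sub>2 \<mapsto> t e\<^sub>2\<close>, \<open>x \<mapsto> x\<close> rescale \<open>(b, a)\<close>, while \<open>exp (c ad e\<^sub>2)\<close> replaces \<open>a\<close> by
  \<open>a + b c (3 - 2n - 2\<lambda>)\<close>. Hence, when \<open>b \<noteq> 0\<close>, the parameter \<open>a\<close> can be removed unless \<open>\<lambda> = (3-2n)/2\<close>.\<close>

subsection \<open>The bracket in coordinates\<close>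

context complex_lie_algebra
begin

lemma br_add_left: "br (u + v) w = br u w + br v w"
  and br_add_right: "br w (u + v) = br w u + br w v"
  and br_scale_left: "br (scale r u) w = scale r (br u w)"
  and br_scale_right: "br w (scale r u) = scale r (br w u)"
  using br_bilinear by (auto simp: bilinear_op_def Vector_Spaces.linear_iff)

lemma br_anticommute: "br u v = - br v u"
proof -
  have "0 = br (u + v) (u + v)" by (simp only: br_alternating)
  also have "\<dots> = br u v + br v u"
    by (simp only: br_add_left br_add_right) (simp add: br_alternating)
  finally show ?thesis by (simp add: eq_neg_iff_add_eq_0)
qed

end

context r_lie_algebra
begin

definition E :: "nat \<Rightarrow> 'a" where
  "E i = (if i = 0 then x else e i)"

text \<open>Index 0 stands for \<open>x\<close>, so a single family \<open>E\<close> over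
  \<open>{..2*n}\<close> is the basis. Beyond \<open>2*n\<close> the values of \<open>e\<close> are
  arbitrary, hence the bounds on indices in what follows.\<close>

definition coord :: "nat \<Rightarrow> 'a \<Rightarrow> complex" where
  "coord k v = representation (r_basis n e x) v (E k)"

text \<open>The eigenvalues of \<open>[-, x]\<close> on the basis.\<close>

definition wt :: "nat \<Rightarrow> complex" where
  "wt i = (if i = 0 then 0 else if i = 1 then 1
     else if i = 2*n then 2 * of_nat n - 3 + 2 * lam else of_nat i - 2 + lam)"

lemma r_basis_eq: "r_basis n e x = E ` {..2*n}"
proof -
  have "{..2*n} = insert 0 {1..2*n}" by auto
  moreover have "E ` {1..2*n} = e ` {1..2*n}" by (rule image_cong) (auto simp: E_def)
  moreover have "E 0 = x" by (simp add: E_def)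
  ultimately show ?thesis by (simp only: r_basis_def image_insert)
qed

lemma E_inj: "inj_on E {..2*n}"
proof -
  have "{..2*n} = insert 0 {1..2*n}" by auto
  moreover have "inj_on E {1..2*n}"
    using e_inj by (subst inj_on_cong[of _ E e]) (auto simp: E_def)
  moreover have "E 0 \<notin> E ` ({1..2*n} - {0})"
    using x_notin by (auto simp: E_def)
  ultimately show ?thesis by simp
qed

lemma coord_add [simp]: "coord k (u + v) = coord k u + coord k v"
  and coord_scale [simp]: "coord k (scale r u) = r * coord k u"
  and coord_zero [simp]: "coord k 0 = 0"
  and coord_neg [simp]: "coord k (- u) = - coord k u"
  and coord_diff [simp]: "coord k (u - v) = coord k u - coord k v"
  using basis_independent basis_span
  by (simp_all add: coord_def representation_add representation_scale representation_zero
        representation_neg representation_diff)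

lemma coord_E: "\<lbrakk>i \<le> 2*n; k \<le> 2*n\<rbrakk> \<Longrightarrow> coord k (E i) = (if k = i then 1 else 0)"
  unfolding coord_def
  by (subst representation_basis[OF basis_independent])
     (use E_inj in \<open>auto simp: r_basis_eq inj_on_def\<close>)

lemma coord_expansion: "v = (\<Sum>i\<le>2*n. scale (coord i v) (E i))"
proof -
  have "(\<Sum>b\<in>r_basis n e x. scale (representation (r_basis n e x) v b) b) = v"
    by (rule sum_representation_eq) (use basis_independent basis_span in \<open>auto simp: r_basis_eq\<close>)
  then show ?thesis
    by (simp add: r_basis_eq sum.reindex[OF E_inj] coord_def)
qed

lemma coord_sum: "coord k (sum f A) = (\<Sum>i\<in>A. coord k (f i))"
  by (induction A rule: infinite_finite_induct) auto

lemma coord_eqI: "(\<And>k. k \<le> 2*n \<Longrightarrow> coord k u = coord k v) \<Longrightarrow> u = v"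
  by (subst coord_expansion[of u], subst coord_expansion[of v]) (auto intro!: sum.cong)

text \<open>Linearity is asked for as two bare equations, so that coordinate expressions with case
  distinctions can be checked by simplification alone.\<close>

lemma functional_eqI:
  fixes f g :: "'a \<Rightarrow> complex"
  assumes f: "\<And>u v. f (u + v) = f u + f v" "\<And>r u. f (scale r u) = r * f u"
    and g: "\<And>u v. g (u + v) = g u + g v" "\<And>r u. g (scale r u) = r * g u"
    and eq: "\<And>i. i \<le> 2*n \<Longrightarrow> f (E i) = g (E i)"
  shows "f v = g v"
proof -
  have *: "h (sum p A) = (\<Sum>i\<in>A. h (p i))"
    if "\<And>u v. h (u + v) = h u + h v" "\<And>r u. h (scale r u) = r * h u"
    for h :: "'a \<Rightarrow> complex" and p and A :: "nat set"
  proof -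
    have "h 0 = 0" using that(2)[of 0 0] by simp
    then show ?thesis by (induction A rule: infinite_finite_induct) (auto simp: that)
  qed
  show ?thesis
    by (subst (1 2) coord_expansion[of v]) (auto simp: *[of f] *[of g] f g eq intro!: sum.cong)
qed

lemma linear_map_eqI:
  fixes f g :: "'a \<Rightarrow> 'a"
  assumes "\<And>u v. f (u + v) = f u + f v" "\<And>r u. f (scale r u) = scale r (f u)"
    and "\<And>u v. g (u + v) = g u + g v" "\<And>r u. g (scale r u) = scale r (g u)"
    and "\<And>i. i \<le> 2*n \<Longrightarrow> f (E i) = g (E i)"
  shows "f v = g v"
proof (rule coord_eqI)
  fix k
  show "coord k (f v) = coord k (g v)"
    by (rule functional_eqI) (simp_all add: assms)
qed

end

locale r_lie_algebra_generic = r_lie_algebra +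
  assumes n_ge: "n \<ge> 3"
    and lam_ne: "lam \<noteq> 2 * of_nat n - 3" "lam \<noteq> (5 - 2 * of_nat n) / 2"
begin

lemma n_bounds: "5 \<le> 2*n-1" "6 \<le> 2*n"
  using n_ge by auto

section \<open>Full bracket table and the coordinates of \<open>br v (E j)\<close>\<close>

lemma br_E_0: "i \<le> 2*n \<Longrightarrow> br (E i) (E 0) = scale (wt i) (E i)"
  using br_e1_x br_e_x[of i] br_e2n_x n_ge
  by (auto simp: E_def wt_def br_alternating)

lemma br_E_1:
  assumes "i \<le> 2*n"
  shows "br (E i) (E 1) = (if i = 0 then - E 1 else if 2 \<le> i \<and> i \<le> 2*n-2 then E (i+1) else 0)"
proof -
  consider "i = 0" | "i = 1" | "2 \<le> i" "i \<le> 2*n-2" | "2*n-1 \<le> i" "i \<ge> 2" using n_ge by linarith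
  then show ?thesis
  proof cases
    case 1 then show ?thesis using br_anticommute[of x "e 1"] br_e1_x by (simp add: E_def)
  next
    case 2 then show ?thesis by (simp add: br_alternating)
  next
    case 3 then show ?thesis using br_e_e1[of i] by (simp add: E_def)
  next
    case 4
    have "\<not> r_listed n i 1" "\<not> r_listed n 1 i" using 4 n_ge by (auto simp: r_listed_def)
    then show ?thesis using br_e_e_zero[of i 1] 4 assms n_ge by (auto simp: E_def)
  qed
qed

lemma br_E_E:
  assumes "i \<le> 2*n" "2 \<le> j" "j \<le> 2*n-1"
  shows "br (E i) (E j) = (if i = 0 then - scale (wt j) (E j)
    else if i = 1 then (if j \<le> 2*n-2 then - E (j+1) else 0)
    else if i = 2*n+1-j then scale ((-1)^(j+1)) (E (2*n)) else 0)"
proof -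
  have a: "br (E i) (E j) = - br (E j) (E i)" by (rule br_anticommute)
  consider "i = 0" | "i = 1" | "2 \<le> i" "i = 2*n+1-j" | "2 \<le> i" "i \<noteq> 2*n+1-j" by linarith
  then show ?thesis
  proof cases
    case 1 then show ?thesis using a br_E_0[of j] assms by simp
  next
    case 2 then show ?thesis using a br_E_1[of j] assms by auto
  next
    case 3
    show ?thesis
    proof (cases "j \<le> n")
      case True
      then have "br (e j) (e (2*n+1-j)) = scale ((-1)^j) (e (2*n))" using assms by (intro br_e_e) auto
      then show ?thesis using 3 a assms by (auto simp: E_def)
    next
      case False
      \<comment> \<open>The table lists a pair with the smaller index first, which here is
        \<open>i\<close>; since \<open>i + j = 2*n + 1\<close> is odd, its sign
        \<open>(-1)^i\<close> agrees with the claimed one.\<close>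
      have "even i = odd j" using 3 assms by (auto simp: even_diff_nat)
      then have "(-1)^i = ((-1)^(j+1) :: complex)" by (simp add: minus_one_power_iff)
      moreover have "br (e i) (e (2*n+1-i)) = scale ((-1)^i) (e (2*n))"
        using 3 False assms by (intro br_e_e) auto
      moreover have "2*n+1-i = j" using 3 assms by auto
      ultimately show ?thesis using 3 assms by (auto simp: E_def)
    qed
  next
    case 4
    have "\<not> r_listed n i j" "\<not> r_listed n j i" using 4 assms by (auto simp: r_listed_def)
    then show ?thesis using br_e_e_zero[of i j] 4 assms by (auto simp: E_def)
  qed
qed

lemma br_E_2n:
  assumes "i \<le> 2*n"
  shows "br (E i) (E (2*n)) = (if i = 0 then - scale (wt (2*n)) (E (2*n)) else 0)"
proof -
  have a: "br (E i) (E (2*n)) = - br (E (2*n)) (E i)" by (rule br_anticommute)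
  consider "i = 0" | "i = 1" | "2 \<le> i" "i \<le> 2*n-1" | "i = 2*n" using assms by linarith
  then show ?thesis
  proof cases
    case 1 then show ?thesis using a br_E_0[of "2*n"] by simp
  next
    case 2 then show ?thesis using a br_E_1[of "2*n"] n_ge by auto
  next
    case 3
    then have "br (E (2*n)) (E i) = 0" using br_E_E[of "2*n" i] n_ge by auto
    then show ?thesis using a 3 by simp
  next
    case 4 then show ?thesis using n_ge by (simp add: br_alternating)
  qed
qed

lemma coord_br_0:
  assumes "k \<le> 2*n"
  shows "coord k (br v (E 0)) = wt k * coord k v"
proof (rule functional_eqI[where v = v])
  fix i assume "i \<le> 2*n"
  then show "coord k (br (E i) (E 0)) = wt k * coord k (E i)"
    using assms by (simp add: br_E_0 coord_E)
qed (simp_all add: br_add_left br_scale_left ring_distribs)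

lemma coord_br_1:
  assumes "k \<le> 2*n"
  shows "coord k (br v (E 1)) =
    (if k = 1 then - coord 0 v else if 3 \<le> k \<and> k \<le> 2*n-1 then coord (k-1) v else 0)"
    (is "_ = ?g v")
proof (rule functional_eqI[where v = v])
  fix i assume i: "i \<le> 2*n"
  have *: "k - 1 \<le> 2*n" using assms by linarith
  consider "i = 0" | "i = 1" | "2 \<le> i" "i \<le> 2*n-2" | "i > 2*n-2" "i > 1" by linarith
  then show "coord k (br (E i) (E 1)) = ?g (E i)"
    by cases (use assms i n_ge * in \<open>auto simp: br_E_1 coord_E simp del: One_nat_def\<close>)
qed (simp_all add: br_add_left br_scale_left)

lemma coord_br_E:
  assumes "k \<le> 2*n" "2 \<le> j" "j \<le> 2*n-1"
  shows "coord k (br v (E j)) =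
    (if k = j then - wt j * coord 0 v else if k = j+1 \<and> k \<le> 2*n-1 then - coord 1 v
     else if k = 2*n then (-1)^(j+1) * coord (2*n+1-j) v else 0)" (is "_ = ?g v")
proof (rule functional_eqI[where v = v])
  fix i assume i: "i \<le> 2*n"
  have *: "j \<le> 2*n" "j \<noteq> 0" "1 \<le> 2*n" "j + 1 \<le> 2*n" "2*n+1-j \<le> 2*n" "2*n+1-j > 1"
    using assms by auto
  have **: "j + 1 \<le> 2*n-1 \<longleftrightarrow> j \<le> 2*n-2" using assms by auto
  have ***: "2*n - 1 < 2*n" using assms by simp
  consider "i = 0" | "i = 1" | "2 \<le> i" "i = 2*n+1-j" | "2 \<le> i" "i \<noteq> 2*n+1-j" by linarith
  then show "coord k (br (E i) (E j)) = ?g (E i)"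
    by cases (use assms i * ** *** in \<open>auto simp: br_E_E coord_E simp del: One_nat_def power_Suc\<close>)
qed (use n_ge in \<open>auto simp: br_add_left br_scale_left ring_distribs\<close>)

lemma coord_br_2n:
  assumes "k \<le> 2*n"
  shows "coord k (br v (E (2*n))) = (if k = 2*n then - wt k * coord 0 v else 0)" (is "_ = ?g v")
proof (rule functional_eqI[where v = v])
  fix i assume "i \<le> 2*n"
  then show "coord k (br (E i) (E (2*n))) = ?g (E i)"
    using assms by (cases "i = 0") (auto simp: br_E_2n coord_E)
qed (simp_all add: br_add_left br_scale_left ring_distribs)

end

subsection \<open>Half-derivations\<close>

locale r_half_derivation = r_lie_algebra_generic +
  fixes \<phi> :: "'a \<Rightarrow> 'a"
  assumes phi_add: "\<phi> (u + v) = \<phi> u + \<phi> v"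
    and phi_scale: "\<phi> (scale r u) = scale r (\<phi> u)"
    and phi_half: "scale 2 (\<phi> (br u v)) = br (\<phi> u) v + br u (\<phi> v)"
begin

text \<open>The matrix of \<open>\<phi>\<close>: the first index is the row (coordinate), the second
  the column (argument).\<close>

definition M :: "nat \<Rightarrow> nat \<Rightarrow> complex" where
  "M k i = coord k (\<phi> (E i))"

section \<open>Linear equations for the matrix of a half-derivation\<close>

lemma phi_zero: "\<phi> 0 = 0"
  using phi_scale[of 0 0] by simp

text \<open>The second bracket is reversed so that \<open>\<phi>\<close> sits in the left argument
  of both terms, the side on which coordinates of brackets are known.\<close>

lemma half_coord: "2 * coord k (\<phi> (br u v)) = coord k (br (\<phi> u) v) - coord k (br (\<phi> v) u)"
  using arg_cong[OF phi_half[of u v], of "coord k"] by (simp add: br_anticommute[of u "\<phi> v"])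

lemma half_0:
  assumes "i \<le> 2*n" "k \<le> 2*n"
  shows "2 * wt i * M k i = wt k * M k i - coord k (br (\<phi> (E 0)) (E i))"
  using half_coord[of k "E i" "E 0"] assms
  by (simp add: M_def br_E_0 phi_scale coord_br_0 mult.assoc)

lemma half_0_E:
  assumes "k \<le> 2*n" "2 \<le> i" "i \<le> 2*n-1"
  shows "2 * wt i * M k i = wt k * M k i - (if k = i then - wt i * M 0 0
      else if k = i+1 \<and> k \<le> 2*n-1 then - M 1 0
      else if k = 2*n then (-1)^(i+1) * M (2*n+1-i) 0 else 0)"
proof -
  have "i \<le> 2*n" using assms by simp
  from half_0[OF this assms(1)] show ?thesis
    unfolding coord_br_E[OF assms] M_def[symmetric] .
qed

lemma half_0_1:
  assumes "k \<le> 2*n"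
  shows "2 * M k 1 = wt k * M k 1 -
    (if k = 1 then - M 0 0 else if 3 \<le> k \<and> k \<le> 2*n-1 then M (k-1) 0 else 0)"
proof -
  have "1 \<le> 2*n" "wt 1 = 1" using n_ge by (simp_all add: wt_def)
  from half_0[OF this(1) assms] this(2) show ?thesis
    unfolding coord_br_1[OF assms] M_def[symmetric] by (simp only: mult_1_right)
qed

lemma coord_phi_if: "coord k (\<phi> (if c then E i else 0)) = (if c then M k i else 0)"
  by (simp add: M_def phi_zero)

lemma half_1_E:
  assumes "k \<le> 2*n" "2 \<le> i" "i \<le> 2*n-1"
  shows "2 * (if i \<le> 2*n-2 then M k (i+1) else 0) =
    (if k = 1 then - M 0 i else if 3 \<le> k \<and> k \<le> 2*n-1 then M (k-1) i else 0) -
    (if k = i then - wt i * M 0 1 else if k = i+1 \<and> k \<le> 2*n-1 then - M 1 1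
      else if k = 2*n then (-1)^(i+1) * M (2*n+1-i) 1 else 0)"
proof -
  have *: "br (E i) (E 1) = (if i \<le> 2*n-2 then E (i+1) else 0)"
    using br_E_1[of i] assms by auto
  show ?thesis
    using half_coord[of k "E i" "E 1"]
    unfolding * coord_phi_if coord_br_1[OF assms(1)] coord_br_E[OF assms] M_def[symmetric] .
qed

text \<open>Most brackets of \<open>e 2\<close> with another \<open>e i\<close> vanish, so for these
  \<open>i\<close> the two terms on the right must cancel each other.\<close>

lemma half_2_E:
  assumes "k \<le> 2*n" "2 \<le> i" "i \<le> 2*n-1"
  shows "2 * (if i = 2*n-1 then M k (2*n) else 0) =
    (if k = i then - wt i * M 0 2 else if k = i+1 \<and> k \<le> 2*n-1 then - M 1 2
     else if k = 2*n then (-1)^(i+1) * M (2*n+1-i) 2 else 0) -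
    (if k = 2 then - wt 2 * M 0 i else if k = 3 then - M 1 i
     else if k = 2*n then - M (2*n-1) i else 0)"
proof -
  have *: "br (E 2) (E i) = (if i = 2*n-1 then E (2*n) else 0)"
    using br_E_E[of 2 i] assms n_ge by (auto simp: minus_one_power_iff)
  have **: "coord k (br v (E 2)) = (if k = 2 then - wt 2 * coord 0 v else if k = 3 then - coord 1 v
     else if k = 2*n then - coord (2*n-1) v else 0)" for v
    using coord_br_E[of k 2 v] assms n_ge by auto
  show ?thesis
    using half_coord[of k "E 2" "E i"]
    unfolding * ** coord_phi_if coord_br_E[OF assms] M_def[symmetric] .
qed

text \<open>No bracket with \<open>e 1\<close> has a component along \<open>e (2*n)\<close>, so only
  \<open>[e i, \<phi> (e 1)]\<close> contributes at this coordinate.\<close>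

lemma half_1_E_2n:
  assumes "2 \<le> i" "i \<le> 2*n-1"
  shows "2 * (if i \<le> 2*n-2 then M (2*n) (i+1) else 0) = (-1)^i * M (2*n+1-i) 1"
proof -
  have *: "2*n \<noteq> 1" "\<not> (3 \<le> 2*n \<and> 2*n \<le> 2*n-1)" "2*n \<noteq> i" "\<not> (2*n = i+1 \<and> 2*n \<le> 2*n-1)"
    using assms by linarith+
  show ?thesis
    using half_1_E[of "2*n" i] assms unfolding if_not_P[OF *(1)] if_not_P[OF *(2)]
      if_not_P[OF *(3)] if_not_P[OF *(4)] by simp
qed

lemma wt_simps: "wt 0 = 0" "wt 1 = 1" "wt (2*n) = 2 * of_nat n - 3 + 2 * lam"
    "\<lbrakk>2 \<le> i; i \<le> 2*n-1\<rbrakk> \<Longrightarrow> wt i = of_nat i - 2 + lam"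
  using n_ge by (auto simp: wt_def)

section \<open>Column of \<open>e 1\<close>, with parts of the column of \<open>x\<close> and of the
  last row\<close>

lemma M_0_1: "M 0 1 = 0"
  using half_0_1[of 0] by (simp add: wt_simps)

lemma M_1_1: "M 1 1 = M 0 0"
  using half_0_1[of 1] n_ge by (simp add: wt_simps del: One_nat_def)

text \<open>The pair \<open>(e 1, x)\<close> forces \<open>wt (2*n) = 2\<close> unless the entry
  vanishes, and that means \<open>lam = (5 - 2*n) / 2\<close>.\<close>

lemma M_2n_1: "M (2*n) 1 = 0"
proof -
  have "2 * M (2*n) 1 = wt (2*n) * M (2*n) 1" using half_0_1[of "2*n"] n_ge by auto
  then have "(5 - 2 * of_nat n - 2 * lam) * M (2*n) 1 = 0" unfolding wt_simps(3) by algebra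
  moreover have "5 - 2 * of_nat n - 2 * lam \<noteq> 0" using lam_ne(2) by (auto simp: field_simps)
  ultimately show ?thesis by (simp del: One_nat_def)
qed

text \<open>The three entries satisfy three homogeneous linear equations, from
  \<open>[e 1, x]\<close>, \<open>[e (i-1), e 1] = e i\<close> and \<open>[e i, x]\<close>.
  Elimination leaves the factor \<open>2*n - 5 + 2*lam\<close>, which is nonzero by the second
  condition on \<open>lam\<close>.\<close>

lemma M_k_1_aux:
  assumes "3 \<le> k" "k \<le> 2*n-1"
  shows "M k 1 = 0" "M (k-1) 0 = 0" "M (2*n) (2*n+2-k) = 0"
proof -
  \<comment> \<open>This \<open>i\<close> is the partner of \<open>k-1\<close>, and
    \<open>i-1\<close> the partner of \<open>k\<close>: the indices of each pair add up to
    \<open>2*n+1\<close>, so their bracket is a multiple of \<open>e (2*n)\<close>.\<close>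
  define i where "i = 2*n+2-k"
  have i: "3 \<le> i" "i \<le> 2*n-1" "k = 2*n+2-i" using assms by (auto simp: i_def)
  have k': "2*n+1-(i-1) = k" "2*n+1-i = k-1" using i by auto
  have nz: "of_nat k = 2 * of_nat n + 2 - (of_nat i :: complex)" using i by (simp add: of_nat_diff)
  have 1: "2 * M k 1 = wt k * M k 1 - M (k-1) 0" using half_0_1[of k] assms by auto
  have 2: "2 * M (2*n) i = - ((-1)^i * M k 1)"
    using half_1_E_2n[of "i-1"] i k' by (cases i) (auto split: if_splits)
  have 3: "2 * wt i * M (2*n) i = wt (2*n) * M (2*n) i + (-1)^i * M (k-1) 0"
    using half_0_E[of "2*n" i] i k' n_ge by auto
  define s :: complex where "s = (-1)^i"
  have s: "s * s = 1" by (simp add: s_def flip: power_add) 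
  have m: "2 * M (2*n) i = - (s * M k 1)" using 2 by (simp add: s_def)
  have "(2 * wt i - wt (2*n)) * (2 * M (2*n) i) = 2 * s * M (k-1) 0"
    using 3 by (simp add: s_def algebra_simps)
  then have "s * ((2 * wt i - wt (2*n)) * M k 1 + 2 * M (k-1) 0) = 0"
    unfolding m by (simp add: algebra_simps)
  moreover have "s \<noteq> 0" using s by auto
  ultimately have "(2 * wt i - wt (2*n)) * M k 1 + 2 * M (k-1) 0 = 0" by simp
  moreover have "M (k-1) 0 = (wt k - 2) * M k 1" using 1 by (simp add: algebra_simps)
  ultimately have "(2 * wt i - wt (2*n) + 2 * wt k - 4) * M k 1 = 0" by algebra
  moreover have "2 * wt i - wt (2*n) + 2 * wt k - 4 = 2 * of_nat n - 5 + 2 * lam"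
    using i assms by (simp add: wt_simps nz)
  moreover have "2 * of_nat n - 5 + 2 * lam \<noteq> 0" using lam_ne(2) by (auto simp: field_simps)
  ultimately show *: "M k 1 = 0" by (simp del: One_nat_def)
  show "M (k-1) 0 = 0" using 1 * by simp
  show "M (2*n) (2*n+2-k) = 0" using 2 * by (simp add: i_def)
qed

lemma M_k_1: "\<lbrakk>k \<le> 2*n; k \<noteq> 1\<rbrakk> \<Longrightarrow> M k 1 = 0"
proof -
  \<comment> \<open>Row 2 comes from \<open>[e (2*n-1), e 1] = 0\<close>, as 2 is the partner of
    \<open>2*n-1\<close>.\<close>
  have "2*n+1-(2*n-1) = 2" "\<not> 2*n-1 \<le> 2*n-2" using n_ge by auto
  then have "M 2 1 = 0" using half_1_E_2n[of "2*n-1"] n_ge by (simp del: One_nat_def)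
  moreover assume "k \<le> 2*n" "k \<noteq> 1"
  then consider "k = 0" | "k = 2" | "3 \<le> k" "k \<le> 2*n-1" | "k = 2*n" by linarith
  ultimately show ?thesis using M_0_1 M_2n_1 M_k_1_aux(1)[of k] by cases auto
qed

lemma M_k_0: "\<lbrakk>2 \<le> k; k \<le> 2*n-2\<rbrakk> \<Longrightarrow> M k 0 = 0"
  using M_k_1_aux(2)[of "k+1"] by auto

lemma M_2n_E: "\<lbrakk>3 \<le> i; i \<le> 2*n-1\<rbrakk> \<Longrightarrow> M (2*n) i = 0"
  using M_k_1_aux(3)[of "2*n+2-i"] by auto

section \<open>Columns of \<open>e 2\<close>, ..., \<open>e (2*n)\<close>\<close>

lemma M_rec:
  assumes "k \<le> 2*n" "2 \<le> i" "i \<le> 2*n-2"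
  shows "2 * M k (i+1) =
    (if k = 1 then - M 0 i else if 3 \<le> k \<and> k \<le> 2*n-1 then M (k-1) i else 0) +
    (if k = i+1 then M 0 0 else 0)"
proof -
  have *: "M (2*n+1-i) 1 = 0" using assms by (intro M_k_1) auto
  show ?thesis using half_1_E[of k i] assms M_0_1 M_1_1 * by auto
qed

text \<open>Iterates \<open>M_rec\<close>, which halves an entry while moving it one row down and
  one column on. As \<open>3 \<le> j\<close>, the path stays strictly below the diagonal and never
  picks up \<open>M 0 0\<close>.\<close>

lemma M_shift: "\<lbrakk>3 \<le> j; j + m \<le> 2*n-1\<rbrakk> \<Longrightarrow> 2^m * M (j+m) (m+2) = M j 2"
proof (induction m)
  case (Suc m)
  have "2 * M (j + m + 1) (m + 2 + 1) = M (j+m) (m+2)"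
    using M_rec[of "j+m+1" "m+2"] Suc.prems by auto
  moreover have "2^m * M (j+m) (m+2) = M j 2" using Suc by simp
  moreover have "2^Suc m * M (j+m+1) (m+2+1) = 2^m * (2 * M (j+m+1) (m+2+1))" by (simp only: power_Suc ac_simps)
  ultimately have "2^Suc m * M (j+m+1) (m+2+1) = M j 2" by simp
  then show ?case by simp
qed (simp add: numeral_2_eq_2)

lemma M_1_2: "M 1 2 = 0"
  using half_2_E[of 4 3] n_bounds by auto

text \<open>Two relations with coefficients \<open>2*lam + 3\<close> and \<open>lam\<close>, which
  cannot both vanish, so no condition on \<open>lam\<close> is required.\<close>

lemma M_0_2: "M 0 2 = 0"
proof -
  have "2 * M 1 3 = - M 0 2" using M_rec[of 1 2] n_ge by auto
  moreover have "- wt 3 * M 0 2 + M 1 3 = 0" using half_2_E[of 3 3] n_bounds by auto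
  ultimately have "(2 * lam + 3) * M 0 2 = 0" using n_ge by (simp add: wt_simps) algebra
  moreover have "lam * M 0 2 = 0" using half_0_E[of 0 2] n_ge by (simp add: wt_simps)
  ultimately show ?thesis by algebra
qed

lemma M_k_2:
  assumes "3 \<le> k" "k \<le> 2*n-1"
  shows "M k 2 = 0"
proof (cases "k = 2*n-1")
  case True
  \<comment> \<open>The eigenvalue identity \<open>2 * wt 2 = wt (2*n-1)\<close> would mean
    \<open>lam = 2*n - 3\<close>, which is excluded.\<close>
  have "2 * wt 2 * M k 2 = wt k * M k 2" using half_0_E[of k 2] True n_ge by auto
  then have "(lam - (2 * of_nat n - 3)) * M k 2 = 0"
    using True n_ge by (simp add: wt_simps algebra_simps of_nat_diff)
  then show ?thesis using lam_ne(1) by simp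
next
  case False
  \<comment> \<open>From \<open>[e 2, e i] = 0\<close> the entry \<open>M k 2\<close> equals
    \<open>M (2*n-1) i\<close> up to sign, while \<open>M_shift\<close> makes the latter smaller by
    the factor \<open>2^(i-2) > 1\<close>. Comparing absolute values leaves only zero.\<close>
  define i where "i = 2*n+1-k"
  have i: "3 \<le> i" "i \<le> 2*n-2" "2*n+1-i = k" using assms False by (auto simp: i_def)
  have "k + (i - 2) = 2*n-1" "i - 2 + 2 = i" using i assms by auto
  then have 1: "2^(i-2) * M (2*n-1) i = M k 2" using M_shift[of k "i-2"] assms by simp
  have "(-1)^(i+1) * M k 2 + M (2*n-1) i = 0" proof -
    have *: "i \<noteq> 2*n-1" "2*n \<noteq> i" "\<not> (2*n = i+1 \<and> 2*n \<le> 2*n-1)" "2*n \<noteq> 2" "2*n \<noteq> 3"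
      using i n_ge by linarith+
    show ?thesis
      using half_2_E[of "2*n" i] i unfolding if_not_P[OF *(1)] if_not_P[OF *(2)]
        if_not_P[OF *(3)] if_not_P[OF *(4)] if_not_P[OF *(5)] by simp
  qed
  then have "2^(i-2) * ((-1)^(i+1) * M k 2 + M (2*n-1) i) = 0" by simp
  then have "((-1)^(i+1) * 2^(i-2) + 1) * M k 2 = 0" using 1 by (simp add: ring_distribs mult_ac)
  moreover have "(-1)^(i+1) * 2^(i-2) + 1 \<noteq> (0::complex)"
  proof
    assume "(-1)^(i+1) * 2^(i-2) + 1 = (0::complex)"
    then have "(-1)^(i+1) * 2^(i-2) = (-1 :: complex)" by (simp only: eq_neg_iff_add_eq_0)
    then have "norm ((-1)^(i+1) * 2^(i-2) :: complex) = norm (-1 :: complex)" by (simp only:)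
    then have "(2::real)^(i-2) = 1" by (simp add: norm_mult norm_power)
    moreover have "(2::real)^(i-2) > 1" using i by (intro one_less_power) auto
    ultimately show False by simp
  qed
  ultimately show ?thesis by simp
qed

lemma M_1_0: "M 1 0 = 0"
  using half_0_E[of 3 2] M_k_2[of 3] n_bounds by auto

text \<open>The difference \<open>M 2 2 - M 0 0\<close> is annihilated by \<open>lam\<close>, and,
  through column 3, by \<open>1 + lam\<close>.\<close>

lemma M_2_2: "M 2 2 = M 0 0"
proof -
  have 1: "2 * M 3 3 = M 2 2 + M 0 0" using M_rec[of 3 2] n_ge by auto
  have "2 * wt 2 * M 2 2 = wt 2 * M 2 2 + wt 2 * M 0 0" using half_0_E[of 2 2] n_ge by auto
  moreover have "wt 2 = lam" "wt 3 = 1 + lam" using n_ge by (simp_all add: wt_simps)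
  ultimately have 2: "lam * (M 2 2 - M 0 0) = 0" by algebra
  have "2 * wt 3 * M 3 3 = wt 3 * M 3 3 + wt 3 * M 0 0" using half_0_E[of 3 3] n_ge by auto
  then have "(1 + lam) * (M 3 3 - M 0 0) = 0" using \<open>wt 3 = 1 + lam\<close> by algebra
  then show ?thesis using 1 2 by algebra
qed

text \<open>Origin of the constant in the tables: \<open>2 * wt 2 - wt (2*n) = 3 - 2*n\<close>,
  independently of \<open>lam\<close>.\<close>

lemma M_2n_2: "(3 - 2 * of_nat n) * M (2*n) 2 = M (2*n-1) 0"
proof -
  have "2 * wt 2 * M (2*n) 2 = wt (2*n) * M (2*n) 2 + M (2*n-1) 0"
    using half_0_E[of "2*n" 2] n_ge by auto
  moreover have "wt 2 = lam" using n_ge by (simp add: wt_simps)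
  ultimately show ?thesis unfolding wt_simps(3) by algebra
qed

text \<open>Induction on the column by \<open>M_rec\<close>: a diagonal entry is the mean of the
  preceding one and \<open>M 0 0\<close>, and off the diagonal zeros propagate.\<close>

lemma M_E_step:
  assumes "3 \<le> i" "i \<le> 2*n-1" "k \<le> 2*n"
  shows "M k i = (if k = i then M 0 0 else 0)"
  using assms
proof (induction i arbitrary: k rule: dec_induct)
  case base
  have r: "2 * M k (2+1) = (if k = 1 then - M 0 2 else if 3 \<le> k \<and> k \<le> 2*n-1 then M (k-1) 2 else 0) +
      (if k = 2+1 then M 0 0 else 0)"
    using n_ge base by (intro M_rec) auto
  consider "k = 0" | "k = 1" | "k = 2" | "k = 3" | "4 \<le> k" "k \<le> 2*n-1" | "k = 2*n"
    using base by linarith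
  then show ?case
  proof cases
    case 2 then show ?thesis using r M_0_2 by simp
  next
    case 4 then show ?thesis using r M_2_2 n_bounds by simp
  next
    case 5 then show ?thesis using r M_k_2[of "k-1"] by simp
  next
    case 6 then show ?thesis using M_2n_E[of 3] n_bounds by simp
  qed (use r in simp_all)
next
  case (step i)
  have *: "M l i = (if l = i then M 0 0 else 0)" if "l \<le> 2*n" for l using step that by auto
  have r: "2 * M k (i+1) = (if k = 1 then - M 0 i else if 3 \<le> k \<and> k \<le> 2*n-1 then M (k-1) i else 0) +
      (if k = i+1 then M 0 0 else 0)"
    using step by (intro M_rec) auto
  have "k - 1 \<le> 2*n" "3 \<le> k \<Longrightarrow> k - 1 = i \<longleftrightarrow> k = i + 1" using step by auto
  from r *[of 0] *[OF this(1)] this(2) step show ?case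
    by (cases "3 \<le> k \<and> k \<le> 2*n-1"; cases "k = i + 1"; cases "k = 1") auto
qed

text \<open>The recursion stops at column \<open>2*n-1\<close>; the last column comes from
  \<open>[e 2, e (2*n-1)] = e (2*n)\<close>.\<close>

lemma M_E_2n:
  assumes "k \<le> 2*n"
  shows "M k (2*n) = (if k = 2*n then M 0 0 else 0)"
proof -
  have "M l (2*n-1) = (if l = 2*n-1 then M 0 0 else 0)" if "l \<le> 2*n" for l
    using M_E_step[of "2*n-1" l] that n_ge by auto
  from this[of 0] this[of 1] this[of "2*n-1"]
  have "M 0 (2*n-1) = 0" "M 1 (2*n-1) = 0" "M (2*n-1) (2*n-1) = M 0 0" using n_bounds by auto
  moreover define m where "m = 2*n-1"
  ultimately have M: "M 0 m = 0" "M 1 m = 0" "M m m = M 0 0" by simp_all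
  have m: "2*n = m+1" "2*n-1 = m" "5 \<le> m" "odd m" using n_ge by (auto simp: m_def)
  have "m + 1 + 1 - m = 2" "k \<le> m + 1" "2 \<le> m" using assms m by simp_all
  then show ?thesis
    using half_2_E[of k m] M M_0_2 M_1_2 M_2_2 m(3,4) unfolding m(2) unfolding m(1)
    by (simp split: if_splits)
qed

text \<open>The condition \<open>lam \<noteq> 2 * n - 3\<close> rules out a component of \<open>\<phi> (e 2)\<close> along \<open>e (2*n-1)\<close>, and
  \<open>lam \<noteq> (5 - 2 * n) / 2\<close> rules out components of \<open>\<phi> (e 1)\<close> along \<open>e 3, \<dots>, e (2*n)\<close>.\<close>

lemma half_derivation_form:
  shows "\<phi> (E 0) = scale (M 0 0) (E 0) + scale ((3 - 2 * of_nat n) * M (2*n) 2) (E (2*n-1))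
      + scale (M (2*n) 0) (E (2*n))"
    and "\<phi> (E 2) = scale (M 0 0) (E 2) + scale (M (2*n) 2) (E (2*n))"
    and "\<lbrakk>1 \<le> i; i \<le> 2*n; i \<noteq> 2\<rbrakk> \<Longrightarrow> \<phi> (E i) = scale (M 0 0) (E i)"
proof -
  show "\<phi> (E 0) = scale (M 0 0) (E 0) + scale ((3 - 2 * of_nat n) * M (2*n) 2) (E (2*n-1))
      + scale (M (2*n) 0) (E (2*n))"
  proof (rule coord_eqI)
    fix k assume k: "k \<le> 2*n"
    consider "k = 0" | "k = 1" | "2 \<le> k" "k \<le> 2*n-2" | "k = 2*n-1" | "k = 2*n" using k by linarith
    then have "M k 0 = (if k = 0 then M 0 0 else if k = 2*n-1 then M (2*n-1) 0
      else if k = 2*n then M (2*n) 0 else 0)"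
      by cases (use M_1_0 M_k_0[of k] n_ge in auto)
    then show "coord k (\<phi> (E 0)) = coord k (scale (M 0 0) (E 0)
        + scale ((3 - 2 * of_nat n) * M (2*n) 2) (E (2*n-1)) + scale (M (2*n) 0) (E (2*n)))"
      using k n_ge by (auto simp: coord_E M_2n_2 simp flip: M_def)
  qed
  show "\<phi> (E 2) = scale (M 0 0) (E 2) + scale (M (2*n) 2) (E (2*n))"
  proof (rule coord_eqI)
    fix k assume k: "k \<le> 2*n"
    consider "k = 0" | "k = 1" | "k = 2" | "3 \<le> k" "k \<le> 2*n-1" | "k = 2*n" using k by linarith
    then have "M k 2 = (if k = 2 then M 0 0 else if k = 2*n then M (2*n) 2 else 0)"
      by cases (use M_0_2 M_1_2 M_2_2 M_k_2[of k] n_ge in auto)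
    then show "coord k (\<phi> (E 2)) = coord k (scale (M 0 0) (E 2) + scale (M (2*n) 2) (E (2*n)))"
      using k n_ge by (auto simp: coord_E simp flip: M_def)
  qed
  assume i: "1 \<le> i" "i \<le> 2*n" "i \<noteq> 2"
  show "\<phi> (E i) = scale (M 0 0) (E i)"
  proof (rule coord_eqI)
    fix k assume k: "k \<le> 2*n"
    consider "i = 1" | "3 \<le> i" "i \<le> 2*n-1" | "i = 2*n" using i by linarith
    then have "M k i = (if k = i then M 0 0 else 0)"
      by cases (use M_1_1 M_k_1[of k] M_E_step[of i k] M_E_2n[of k] k in auto)
    then show "coord k (\<phi> (E i)) = coord k (scale (M 0 0) (E i))"
      using k i by (auto simp: coord_E simp flip: M_def)
  qed
qed

end

subsection \<open>Transport of structure along automorphisms\<close>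

context complex_lie_algebra
begin

lemma br_zero_left: "br 0 u = 0" and br_zero_right: "br u 0 = 0"
  using br_scale_left[of 0 0 u] br_scale_right[of u 0 0] by simp_all

lemma br_minus_right: "br u (- v) = - br u v"
  using br_scale_right[of u "-1" v] by simp

lemma br_diff_right: "br w (u - v) = br w u - br w v"
  using br_add_right[of w u "- v"] by (simp add: br_minus_right)

lemma br_derivation: "br w (br u v) = br (br w u) v + br u (br w v)"
proof -
  have "br w (br u v) = - br u (br v w) - br v (br w u)"
    using br_jacobi[of w u v] by (simp add: eq_diff_eq eq_neg_iff_add_eq_0 add_ac)
  also have "br u (br v w) = - br u (br w v)"
    using br_anticommute[of v w] by (simp add: br_minus_right)
  also have "br v (br w u) = - br (br w u) v" by (rule br_anticommute)
  finally show ?thesis by simp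
qed

text \<open>The exponential of \<open>ad w\<close> in the case \<open>(ad w)\<^sup>2 = 0\<close>.\<close>

lemma exp_ad_br:
  assumes sq: "\<And>v. br w (br w v) = 0"
  shows "br u v + scale c (br w (br u v)) = br (u + scale c (br w u)) (v + scale c (br w v))"
proof -
  \<comment> \<open>Applying the derivation \<open>ad w\<close> twice to a bracket isolates the term
    quadratic in \<open>c\<close>, which must therefore vanish.\<close>
  have "br w (br w (br u v)) = scale 2 (br (br w u) (br w v))"
    using scale_left_distrib[of 1 1 "br (br w u) (br w v)"]
    by (simp add: br_derivation[of w u v] br_derivation[of w "br w u"] br_derivation[of w u "br w v"]
        br_add_right sq br_zero_left br_zero_right)
  then have "br (br w u) (br w v) = 0" by (simp add: sq)
  then show ?thesis
    by (simp add: br_derivation[of w u v] br_add_left br_add_right br_scale_left br_scale_right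
        scale_right_distrib)
qed

text \<open>Conjugating a product by a Lie algebra automorphism. Only \<open>\<Phi>\<close> is
  assumed to be a homomorphism; the same properties of \<open>\<Psi>\<close> follow from its being a
  two-sided inverse.\<close>

lemma transport_tp:
  assumes mul: "transposed_poisson_algebra scale br mul"
    and add: "\<And>u v. \<Phi> (u + v) = \<Phi> u + \<Phi> v" and scale: "\<And>r u. \<Phi> (scale r u) = scale r (\<Phi> u)"
    and hom: "\<And>u v. \<Phi> (br u v) = br (\<Phi> u) (\<Phi> v)"
    and inv: "\<And>u. \<Phi> (\<Psi> u) = u" "\<And>u. \<Psi> (\<Phi> u) = u"
  shows "transposed_poisson_algebra scale br (\<lambda>u v. \<Phi> (mul (\<Psi> u) (\<Psi> v)))"
    and "tp_isomorphic scale br mul scale br (\<lambda>u v. \<Phi> (mul (\<Psi> u) (\<Psi> v)))"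
proof -
  interpret mul: transposed_poisson_algebra scale br mul by (rule mul)
  have mul_bil: "mul (u + v) w = mul u w + mul v w" "mul w (u + v) = mul w u + mul w v"
    "mul (scale r u) w = scale r (mul u w)" "mul w (scale r u) = scale r (mul w u)" for u v w r
    using mul.mul_bilinear by (auto simp: bilinear_op_def Vector_Spaces.linear_iff)
  have add': "\<Psi> (u + v) = \<Psi> u + \<Psi> v" for u v using add[of "\<Psi> u" "\<Psi> v"] inv by metis
  have scale': "\<Psi> (scale r u) = scale r (\<Psi> u)" for r u using scale[of r "\<Psi> u"] inv by metis
  have hom': "\<Psi> (br u v) = br (\<Psi> u) (\<Psi> v)" for u v using hom[of "\<Psi> u" "\<Psi> v"] inv by metis
  show "transposed_poisson_algebra scale br (\<lambda>u v. \<Phi> (mul (\<Psi> u) (\<Psi> v)))"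
  proof (unfold_locales, goal_cases)
    case 1
    show ?case
      using vector_space_axioms
      by (simp add: bilinear_op_def Vector_Spaces.linear_iff add' scale' mul_bil add scale)
  next
    case (2 u v) show ?case by (simp add: mul.mul_commute)
  next
    case (3 u v w) show ?case by (simp add: inv mul.mul_assoc)
  next
    case (4 z u v)
    have "scale 2 (mul (\<Psi> z) (br (\<Psi> u) (\<Psi> v))) =
        br (mul (\<Psi> z) (\<Psi> u)) (\<Psi> v) + br (\<Psi> u) (mul (\<Psi> z) (\<Psi> v))"
      by (rule mul.transposed_leibniz)
    from arg_cong[OF this, of \<Phi>] show ?case by (simp add: hom' hom add scale inv)
  qed
  have "bij \<Phi>" by (rule bij_betw_byWitness[where f' = \<Psi>]) (auto simp: inv)
  then show "tp_isomorphic scale br mul scale br (\<lambda>u v. \<Phi> (mul (\<Psi> u) (\<Psi> v)))"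
    using vector_space_axioms unfolding tp_isomorphic_def
    by (intro exI[of _ \<Phi>]) (simp add: Vector_Spaces.linear_iff add scale hom inv)
qed

end

lemma tp_isomorphic_trans:
  assumes "tp_isomorphic s1 b1 m1 s2 b2 m2" "tp_isomorphic s2 b2 m2 s3 b3 m3"
  shows "tp_isomorphic s1 b1 m1 s3 b3 m3"
proof -
  from assms obtain f g where
    "Vector_Spaces.linear s1 s2 f" "bij f" "\<forall>u v. f (b1 u v) = b2 (f u) (f v)"
    "\<forall>u v. f (m1 u v) = m2 (f u) (f v)"
    "Vector_Spaces.linear s2 s3 g" "bij g" "\<forall>u v. g (b2 u v) = b3 (g u) (g v)"
    "\<forall>u v. g (m2 u v) = m3 (g u) (g v)"
    unfolding tp_isomorphic_def by blast
  then show ?thesis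
    unfolding tp_isomorphic_def
    by (intro exI[of _ "g \<circ> f"]) (auto simp: bij_comp Vector_Spaces.linear_iff)
qed

subsection \<open>Products and their normal forms\<close>

context r_lie_algebra_generic
begin

section \<open>The two-parameter family containing every product\<close>

lemma two_n_minus_one_ne: "2*n - 1 \<noteq> 2*n" "2*n \<noteq> 2*n - 1"
  using n_ge by auto

lemma E_eq_iff: "\<lbrakk>i \<le> 2*n; j \<le> 2*n\<rbrakk> \<Longrightarrow> E i = E j \<longleftrightarrow> i = j"
  using E_inj by (auto simp: inj_on_def)

text \<open>Associativity and the Leibniz rule are never verified for this formula: they are
  inherited from the given product by transport.\<close>

definition tp_form :: "complex \<Rightarrow> complex \<Rightarrow> 'a \<Rightarrow> 'a \<Rightarrow> 'a" where
  "tp_form b a u v =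
    scale (b * (coord 2 u * coord 0 v + coord 0 u * coord 2 v) + a * coord 0 u * coord 0 v) (E (2*n))
    + scale ((3 - 2 * of_nat n) * b * coord 0 u * coord 0 v) (E (2*n-1))"

lemma tp_form_linear:
  "tp_form b a (u + v) w = tp_form b a u w + tp_form b a v w"
  "tp_form b a w (u + v) = tp_form b a w u + tp_form b a w v"
  "tp_form b a (scale r u) w = scale r (tp_form b a u w)"
  "tp_form b a w (scale r u) = scale r (tp_form b a w u)"
  by (rule coord_eqI; simp add: tp_form_def algebra_simps)+

lemma tp_form_E:
  assumes "i \<le> 2*n" "j \<le> 2*n"
  shows "tp_form b a (E i) (E j) =
    (if {i, j} = {2, 0} then scale b (E (2*n))
     else if i = 0 \<and> j = 0 then scale a (E (2*n)) + scale ((3 - 2 * of_nat n) * b) (E (2*n-1))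
     else 0)"
  using assms n_ge by (auto simp: tp_form_def coord_E doubleton_eq_iff)

lemma tp_product_form:
  assumes "transposed_poisson_algebra scale br mul"
  shows "\<exists>b a. mul = tp_form b a"
proof -
  interpret mul: transposed_poisson_algebra scale br mul by (rule assms)
  have mul_bil: "mul (u + v) w = mul u w + mul v w" "mul w (u + v) = mul w u + mul w v"
    "mul (scale r u) w = scale r (mul u w)" "mul w (scale r u) = scale r (mul w u)" for u v w r
    using mul.mul_bilinear by (auto simp: bilinear_op_def Vector_Spaces.linear_iff)
  \<comment> \<open>As \<open>mul z\<close> is a half-derivation, its scalar and its two parameters
    become functions of \<open>z\<close>.\<close>
  have "\<exists>\<xi> \<beta> \<alpha>. mul z (E 0) = scale \<xi> (E 0) + scale ((3 - 2 * of_nat n) * \<beta>) (E (2*n-1))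
         + scale \<alpha> (E (2*n))
      \<and> mul z (E 2) = scale \<xi> (E 2) + scale \<beta> (E (2*n))
      \<and> (\<forall>i. 1 \<le> i \<and> i \<le> 2*n \<and> i \<noteq> 2 \<longrightarrow> mul z (E i) = scale \<xi> (E i))" for z
  proof -
    interpret d: r_half_derivation scale br n lam e x "mul z"
      by unfold_locales (simp_all add: mul_bil mul.transposed_leibniz)
    show ?thesis using d.half_derivation_form by blast
  qed
  then obtain \<xi> \<beta> \<alpha> where
    m0: "\<And>z. mul z (E 0) = scale (\<xi> z) (E 0) + scale ((3 - 2 * of_nat n) * \<beta> z) (E (2*n-1))
         + scale (\<alpha> z) (E (2*n))"
    and m2: "\<And>z. mul z (E 2) = scale (\<xi> z) (E 2) + scale (\<beta> z) (E (2*n))"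
    and mi: "\<And>z i. \<lbrakk>1 \<le> i; i \<le> 2*n; i \<noteq> 2\<rbrakk> \<Longrightarrow> mul z (E i) = scale (\<xi> z) (E i)"
    by metis
  have comm: "coord k (mul u v) = coord k (mul v u)" for k u v by (simp add: mul.mul_commute)
  have xi: "\<xi> (E i) = 0" if "1 \<le> i" "i \<le> 2*n" for i
  proof -
    \<comment> \<open>An index other than 2, \<open>i\<close> and \<open>2*n\<close>: the
      \<open>j\<close>-th coordinate is then \<open>\<xi> (E i)\<close> in
      \<open>e i \<cdot> e j\<close> and zero in the opposite order.\<close>
    define j :: nat where "j = (if i = 1 then 3 else 1)"
    have j: "1 \<le> j" "j \<le> 2*n" "j \<noteq> 2" "j \<noteq> i" "j \<noteq> 2*n" using n_ge by (auto simp: j_def)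
    show ?thesis
      using comm[of j "E i" "E j"] j that n_ge m2[of "E j"] mi[of i "E j"] mi[of j "E i"]
      by (cases "i = 2") (simp_all add: coord_E)
  qed
  have "mul (E 0) (E 1) = scale (\<xi> (E 0)) (E 1)" using mi[of 1] n_ge by simp
  then have xi0: "\<xi> (E 0) = 0"
    using comm[of 1 "E 0" "E 1"] m0[of "E 1"] n_bounds by (simp add: coord_E del: One_nat_def)
  \<comment> \<open>For \<open>i = 2\<close>, the product \<open>e 2 \<cdot> x\<close> has
    \<open>e (2*n-1)\<close>-coordinate \<open>(3 - 2*n) * \<beta> (E 2)\<close>, while
    \<open>x \<cdot> e 2\<close> has none. For other \<open>i\<close>, the comparison is between
    \<open>e i \<cdot> e 2\<close> and \<open>e 2 \<cdot> e i\<close>.\<close>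
  have be: "\<beta> (E i) = 0" if "1 \<le> i" "i \<le> 2*n" for i
  proof (cases "i = 2")
    case True
    have "(3 - 2 * of_nat n :: complex) \<noteq> 0"
    proof
      assume "(3 - 2 * of_nat n :: complex) = 0"
      then have "of_nat 3 = (of_nat (2 * n) :: complex)" by simp
      then have "3 = 2 * n" by (simp only: of_nat_eq_iff)
      then show False by presburger
    qed
    moreover have E: "coord (2*n-1) (E 0) = 0" "coord (2*n-1) (E 2) = 0" "coord (2*n-1) (E (2*n)) = 0"
      "coord (2*n-1) (E (2*n-1)) = 1"
      using n_bounds two_n_minus_one_ne by (auto simp: coord_E)
    have "coord (2*n-1) (mul (E 2) (E 0)) = (3 - 2 * of_nat n) * \<beta> (E 2)"
      unfolding m0 coord_add coord_scale E by simp
    moreover have "coord (2*n-1) (mul (E 0) (E 2)) = 0"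
      unfolding m2 coord_add coord_scale E by simp
    ultimately show ?thesis using comm[of "2*n-1" "E 2" "E 0"] True by simp
  next
    case False
    then show ?thesis
      using comm[of "2*n" "E i" "E 2"] m2[of "E i"] mi[of i "E 2"] xi[of i] xi[of 2] that n_ge
      by (simp add: coord_E)
  qed
  have al: "\<alpha> (E i) = (if i = 2 then \<beta> (E 0) else 0)" if "1 \<le> i" "i \<le> 2*n" for i
    using comm[of "2*n" "E i" "E 0"] m0[of "E i"] m2[of "E 0"] mi[of i "E 0"] xi[of i] xi0 be[of i]
      that n_bounds
    by (cases "i = 2") (simp_all add: coord_E)
  have basis: "mul (E i) (E j) = tp_form (\<beta> (E 0)) (\<alpha> (E 0)) (E i) (E j)"
    if ij: "i \<le> 2*n" "j \<le> 2*n" for i j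
  proof -
    consider "j = 0" | "j = 2" | "1 \<le> j" "j \<noteq> 2" by linarith
    then show ?thesis
    proof cases
      case 1
      then show ?thesis
        using m0[of "E i"] xi[of i] xi0 be[of i] al[of i] ij
        by (cases "i = 0") (auto simp: tp_form_E add.commute doubleton_eq_iff)
    next
      case 2
      then show ?thesis
        using m2[of "E i"] xi[of i] xi0 be[of i] ij
        by (cases "i = 0") (auto simp: tp_form_E doubleton_eq_iff)
    next
      case 3
      then show ?thesis
        using mi[of j "E i"] xi[of i] xi0 ij
        by (cases "i = 0") (auto simp: tp_form_E doubleton_eq_iff)
    qed
  qed
  have "mul u v = tp_form (\<beta> (E 0)) (\<alpha> (E 0)) u v" for u v
  proof (rule linear_map_eqI[where v = u])
    fix i assume "i \<le> 2*n"
    note basis = basis[OF this]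
    show "mul (E i) v = tp_form (\<beta> (E 0)) (\<alpha> (E 0)) (E i) v"
      by (rule linear_map_eqI[where v = v]) (simp_all add: mul_bil tp_form_linear basis)
  qed (simp_all add: mul_bil tp_form_linear)
  then show ?thesis by blast
qed

section \<open>The shear \<open>exp (c ad e2)\<close>\<close>

lemma coord_ad_2:
  assumes "k \<le> 2*n"
  shows "coord k (br (E 2) v) = (if k = 2 then lam * coord 0 v else if k = 3 then coord 1 v
     else if k = 2*n then coord (2*n-1) v else 0)"
  using arg_cong[OF br_anticommute[of "E 2" v], of "coord k"] coord_br_E[of k 2 v] assms n_bounds
  by (auto simp: wt_def)

text \<open>The summand with \<open>3 - 2*n\<close> arises when \<open>\<Phi>\<close> moves the
  \<open>e (2*n-1)\<close>-part of \<open>x \<cdot> x\<close> to \<open>e (2*n)\<close>; the one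
  with \<open>-2*lam\<close> arises because \<open>\<Psi> x\<close> has
  \<open>e 2\<close>-coordinate \<open>-c * lam\<close>.\<close>

lemma tp_form_shear:
  assumes "transposed_poisson_algebra scale br (tp_form b a)" "a' = a + b * c * (3 - 2 * of_nat n - 2 * lam)"
  shows "transposed_poisson_algebra scale br (tp_form b a')"
    and "tp_isomorphic scale br (tp_form b a) scale br (tp_form b a')"
proof -
  let ?\<Phi> = "\<lambda>v. v + scale c (br (E 2) v)"
  let ?\<Psi> = "\<lambda>v. v + scale (-c) (br (E 2) v)"
  \<comment> \<open>The image of \<open>ad e2\<close> lies in the span of \<open>e 2\<close>,
    \<open>e 3\<close> and \<open>e (2*n)\<close>, on which \<open>ad e2\<close> vanishes because
    \<open>3 < 2*n-1\<close>.\<close>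
  have sq: "br (E 2) (br (E 2) v) = 0" for v
  proof (rule coord_eqI)
    fix k assume "k \<le> 2*n"
    moreover have "coord 0 (br (E 2) v) = 0" "coord 1 (br (E 2) v) = 0" "coord (2*n-1) (br (E 2) v) = 0"
      using n_bounds coord_ad_2[of 0 v] coord_ad_2[of 1 v] coord_ad_2[of "2*n-1" v] by auto
    ultimately show "coord k (br (E 2) (br (E 2) v)) = coord k 0"
      by (simp add: coord_ad_2 del: One_nat_def)
  qed
  have eq: "tp_form b a' = (\<lambda>u v. ?\<Phi> (tp_form b a (?\<Psi> u) (?\<Psi> v)))"
  proof (intro ext coord_eqI)
    fix u v k assume k: "k \<le> 2*n"
    define p q where "p = ?\<Psi> u" and "q = ?\<Psi> v"
    have pq: "coord 0 p = coord 0 u" "coord 0 q = coord 0 v"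
      "coord 2 p = coord 2 u - c * lam * coord 0 u" "coord 2 q = coord 2 v - c * lam * coord 0 v"
      using n_ge by (simp_all add: p_def q_def coord_ad_2)
    define w where "w = tp_form b a p q"
    have "coord 0 w = 0" "coord 1 w = 0"
      "coord (2*n-1) w = (3 - 2 * of_nat n) * b * coord 0 u * coord 0 v"
      using n_bounds two_n_minus_one_ne by (auto simp: w_def tp_form_def coord_E pq)
    then have "coord k (?\<Phi> w) = coord k w +
        (if k = 2*n then c * ((3 - 2 * of_nat n) * b * coord 0 u * coord 0 v) else 0)"
      using k n_ge by (simp add: coord_ad_2 del: One_nat_def)
    also have "\<dots> = coord k (tp_form b a' u v)"
    proof (cases "k = 2*n")
      case True
      have E: "coord (2*n) (E (2*n)) = 1" "coord (2*n) (E (2*n-1)) = 0"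
        using two_n_minus_one_ne by (simp_all add: coord_E)
      have "b * ((u2 - c * lam * u0) * v0 + u0 * (v2 - c * lam * v0)) + a * u0 * v0
          + c * (N * b * u0 * v0)
        = b * (u2 * v0 + u0 * v2) + (a + b * c * (N - 2 * lam)) * u0 * v0" for u0 u2 v0 v2 N
        by (simp add: algebra_simps)
      then show ?thesis
        unfolding True w_def tp_form_def coord_add coord_scale pq assms(2) E
        by (simp only: mult_1_right mult_zero_right add_0_right simp_thms if_True)
    next
      case False
      then show ?thesis
        using k by (cases "k = 2*n-1") (simp_all add: w_def tp_form_def coord_E pq)
    qed
    finally show "coord k (tp_form b a' u v) = coord k (?\<Phi> (tp_form b a (?\<Psi> u) (?\<Psi> v)))"
      by (simp only: w_def p_def q_def)
  qed
  have \<Phi>: "?\<Phi> (u + v) = ?\<Phi> u + ?\<Phi> v" "?\<Phi> (scale r u) = scale r (?\<Phi> u)"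
    "?\<Phi> (br u v) = br (?\<Phi> u) (?\<Phi> v)" "?\<Phi> (?\<Psi> u) = u" "?\<Psi> (?\<Phi> u) = u" for u v r
    by (rule exp_ad_br[OF sq] | simp add: sq br_add_right br_scale_right br_diff_right scale_right_distrib mult.commute)+
  note t = transport_tp[of _ ?\<Phi> ?\<Psi>, OF assms(1) \<Phi>]
  show "transposed_poisson_algebra scale br (tp_form b a')" unfolding eq by (rule t(1))
  show "tp_isomorphic scale br (tp_form b a) scale br (tp_form b a')" unfolding eq by (rule t(2))
qed

text \<open>The weights of the torus of automorphisms fixing \<open>x\<close>.\<close>

definition diag :: "complex \<Rightarrow> complex \<Rightarrow> nat \<Rightarrow> complex" where
  "diag s t i = (if i = 0 then 1 else if i = 1 then s
    else if i = 2*n then s^(2*n-3) * t^2 else s^(i-2) * t)"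

definition diag_map :: "complex \<Rightarrow> complex \<Rightarrow> 'a \<Rightarrow> 'a" where
  "diag_map s t v = (\<Sum>i\<le>2*n. scale (diag s t i * coord i v) (E i))"

lemma coord_diag_map:
  assumes "k \<le> 2*n"
  shows "coord k (diag_map s t v) = diag s t k * coord k v"
proof -
  have "coord k (diag_map s t v) = (\<Sum>i\<le>2*n. if k = i then diag s t i * coord i v else 0)"
    unfolding diag_map_def coord_sum using assms by (intro sum.cong) (auto simp: coord_E)
  then show ?thesis using assms by simp
qed

lemma diag_map_linear:
  "diag_map s t (u + v) = diag_map s t u + diag_map s t v"
  "diag_map s t (scale r u) = scale r (diag_map s t u)"
  by (rule coord_eqI; simp add: coord_diag_map algebra_simps)+

lemma diag_map_E: "i \<le> 2*n \<Longrightarrow> diag_map s t (E i) = scale (diag s t i) (E i)"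
  by (rule coord_eqI) (simp add: coord_diag_map coord_E)

lemma diag_Suc: "\<lbrakk>2 \<le> i; i \<le> 2*n-2\<rbrakk> \<Longrightarrow> diag s t (i+1) = diag s t 1 * diag s t i"
proof -
  assume i: "2 \<le> i" "i \<le> 2*n-2"
  then have "i + 1 \<noteq> 2*n" "i \<noteq> 2*n" "i + 1 - 2 = Suc (i - 2)" using n_ge by auto
  then show ?thesis using i by (simp add: diag_def del: One_nat_def)
qed

lemma diag_2n:
  assumes "2 \<le> i" "i \<le> 2*n-1"
  shows "diag s t (2*n) = diag s t i * diag s t (2*n+1-i)"
proof -
  define j where "j = 2*n+1-i"
  have j: "2 \<le> j" "j \<le> 2*n-1" "(i-2) + (j-2) = 2*n-3" using assms by (auto simp: j_def)
  have "s^(i-2) * s^(j-2) = s^(2*n-3)" by (simp only: j(3)[symmetric] power_add)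
  moreover have "diag s t (2*n) = s^(2*n-3) * t^2" using assms by (auto simp: diag_def)
  moreover have "diag s t i = s^(i-2) * t" "diag s t j = s^(j-2) * t"
    using assms j(1,2) by (auto simp: diag_def)
  ultimately show ?thesis unfolding j_def[symmetric] by (simp add: power2_eq_square mult_ac)
qed

text \<open>By linearity \<open>v\<close> may be taken in the basis; the claim is then that weights
  multiply along brackets, as in \<open>diag_Suc\<close> and \<open>diag_2n\<close>, with weight 1
  for \<open>x\<close>.\<close>

lemma diag_map_br: "diag_map s t (br u v) = br (diag_map s t u) (diag_map s t v)"
proof (rule linear_map_eqI[where v = v])
  fix i assume i: "i \<le> 2*n"
  show "diag_map s t (br u (E i)) = br (diag_map s t u) (diag_map s t (E i))"
  proof (rule coord_eqI)
    fix k assume k: "k \<le> 2*n"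
    consider "i = 0" | "i = 1" | "2 \<le> i" "i \<le> 2*n-1" | "i = 2*n" using i by linarith
    then show "coord k (diag_map s t (br u (E i))) = coord k (br (diag_map s t u) (diag_map s t (E i)))"
    proof cases
      case 1
      then show ?thesis using k by (simp add: coord_diag_map diag_map_E br_scale_right coord_br_0 diag_def)
    next
      case 2
      have "diag s t k = diag s t 1 * diag s t (k-1)" if "3 \<le> k" "k \<le> 2*n-1"
        using diag_Suc[of "k-1" s t] that by simp
      moreover have "k - 1 \<le> 2*n" "1 \<le> 2*n" "diag s t 0 = 1" using k n_ge by (auto simp: diag_def)
      ultimately show ?thesis
        using 2 k by (simp add: coord_diag_map diag_map_E br_scale_right coord_br_1 del: One_nat_def)
    next
      case 3
      have "diag s t k = diag s t 1 * diag s t i" if "k = i+1" "k \<le> 2*n-1"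
        using diag_Suc[of i s t] that 3 by simp
      moreover have "diag s t k = diag s t i * diag s t (2*n+1-i)" if "k = 2*n"
        using diag_2n[of i s t] that 3 by simp
      moreover have "1 \<le> 2*n" "diag s t 0 = 1" "2*n+1-i \<le> 2*n" using 3 n_ge by (auto simp: diag_def)
      moreover have "coord k (diag_map s t (br u (E i))) = diag s t k * coord k (br u (E i))"
        "coord k (br (diag_map s t u) (diag_map s t (E i))) = diag s t i * coord k (br (diag_map s t u) (E i))"
        using i k by (simp_all add: coord_diag_map diag_map_E br_scale_right)
      ultimately show ?thesis
        unfolding coord_br_E[OF k 3] by (auto simp: coord_diag_map i simp del: One_nat_def)
    next
      case 4
      then show ?thesis
        using k by (simp add: coord_diag_map diag_map_E br_scale_right coord_br_2n) (simp add: diag_def)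
    qed
  qed
qed (simp_all add: diag_map_linear br_add_right br_scale_right)

lemma diag_map_inverse:
  assumes "s \<noteq> 0" "t \<noteq> 0"
  shows "diag_map s t (diag_map (inverse s) (inverse t) v) = v"
proof (rule coord_eqI)
  fix k assume k: "k \<le> 2*n"
  have "diag (inverse s) (inverse t) k = inverse (diag s t k)"
    by (simp add: diag_def power_inverse)
  moreover have "diag s t k \<noteq> 0" using assms by (simp add: diag_def)
  ultimately show "coord k (diag_map s t (diag_map (inverse s) (inverse t) v)) = coord k v"
    using k by (simp add: coord_diag_map)
qed

text \<open>Each coefficient is multiplied by the weight of the product and divided by those of the
  factors (\<open>t\<close> for \<open>e 2\<close>, 1 for \<open>x\<close>). The weight of
  \<open>e (2*n-1)\<close> equals the factor of \<open>b\<close>, so the ratio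
  \<open>3 - 2*n\<close> is preserved.\<close>

lemma tp_form_diag:
  assumes "transposed_poisson_algebra scale br (tp_form b a)" "s \<noteq> 0" "t \<noteq> 0"
    and "b' = b * s^(2*n-3) * t" "a' = a * s^(2*n-3) * t^2"
  shows "transposed_poisson_algebra scale br (tp_form b' a')"
    and "tp_isomorphic scale br (tp_form b a) scale br (tp_form b' a')"
proof -
  let ?\<Phi> = "diag_map s t"
  let ?\<Psi> = "diag_map (inverse s) (inverse t)"
  have "2*n-1-2 = 2*n-3" by simp
  then have d: "diag s t (2*n) = s^(2*n-3) * t^2" "diag s t (2*n-1) = s^(2*n-3) * t"
    "diag s' t' 0 = 1" "diag s' t' 2 = t'" for s' t'
    using n_bounds by (auto simp: diag_def)
  have eq: "tp_form b' a' = (\<lambda>u v. ?\<Phi> (tp_form b a (?\<Psi> u) (?\<Psi> v)))"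
  proof (intro ext coord_eqI)
    fix u v k assume k: "k \<le> 2*n"
    define p q where "p = ?\<Psi> u" and "q = ?\<Psi> v"
    have pq: "coord 0 p = coord 0 u" "coord 0 q = coord 0 v"
      "coord 2 p = coord 2 u / t" "coord 2 q = coord 2 v / t"
      using n_ge by (simp_all add: p_def q_def coord_diag_map d divide_inverse)
    have "coord k (tp_form b' a' u v) = diag s t k * coord k (tp_form b a p q)"
    proof -
      consider "k = 2*n" | "k = 2*n-1" | "k \<noteq> 2*n" "k \<noteq> 2*n-1" by blast
      then show ?thesis
      proof cases
        case 1
        have E: "coord (2*n) (E (2*n)) = 1" "coord (2*n) (E (2*n-1)) = 0"
          using two_n_minus_one_ne by (simp_all add: coord_E)
        have "b * S * t * (u2 * v0 + u0 * v2) + a * S * t^2 * u0 * v0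
          = S * t^2 * (b * (u2 / t * v0 + u0 * (v2 / t)) + a * u0 * v0)" for S u0 u2 v0 v2
          using assms(3) by (simp add: field_simps power2_eq_square)
        then show ?thesis
          unfolding 1 tp_form_def coord_add coord_scale pq assms(4,5) E d
          by (simp only: mult_1_right mult_zero_right add_0_right)
      next
        case 2
        have E: "coord (2*n-1) (E (2*n)) = 0" "coord (2*n-1) (E (2*n-1)) = 1"
          using two_n_minus_one_ne by (simp_all add: coord_E)
        show ?thesis
          unfolding 2 tp_form_def coord_add coord_scale pq assms(4) E d
          by (simp only: mult_1_right mult_zero_right add_0_left) (simp only: mult_ac)
      next
        case 3
        then show ?thesis using k by (simp add: tp_form_def coord_E)
      qed
    qed
    then show "coord k (tp_form b' a' u v) = coord k (?\<Phi> (tp_form b a (?\<Psi> u) (?\<Psi> v)))"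
      using k by (simp only: coord_diag_map p_def q_def)
  qed
  have inv: "?\<Psi> (?\<Phi> v) = v" for v
    using diag_map_inverse[of "inverse s" "inverse t" v] assms(2,3) by simp
  note t = transport_tp[of _ ?\<Phi> ?\<Psi>, OF assms(1) diag_map_linear diag_map_br
      diag_map_inverse[OF assms(2,3)] inv]
  show "transposed_poisson_algebra scale br (tp_form b' a')" unfolding eq by (rule t(1))
  show "tp_isomorphic scale br (tp_form b a) scale br (tp_form b' a')" unfolding eq by (rule t(2))
qed

section \<open>Normal forms and classification\<close>

lemma tp_form_tables:
  shows "TP1 n e x (tp_form 0 1)" and "TP2 scale n e x (tp_form 1 0)"
    and "TP3 scale n e x (tp_form 1 1)"
proof -
  have *: "E i = x \<longleftrightarrow> i = 0" "{E i, E j} = {e 2, x} \<longleftrightarrow> {i, j} = {2, 0}" if "i \<le> 2*n" "j \<le> 2*n" for i j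
  proof -
    have "x = E 0" "e 2 = E 2" by (simp_all add: E_def)
    then have "E i = x \<longleftrightarrow> E i = E 0" "{E i, E j} = {e 2, x} \<longleftrightarrow> {E i, E j} = {E 2, E 0}"
      by (simp_all only:)
    moreover have "2 \<le> 2*n" using n_ge by simp
    ultimately show "E i = x \<longleftrightarrow> i = 0" "{E i, E j} = {e 2, x} \<longleftrightarrow> {i, j} = {2, 0}"
      using that by (simp_all add: doubleton_eq_iff E_eq_iff)
  qed
  have e: "e (2*n) = E (2*n)" "e (2*n-1) = E (2*n-1)" using n_ge by (auto simp: E_def)
  show "TP1 n e x (tp_form 0 1)" "TP2 scale n e x (tp_form 1 0)" "TP3 scale n e x (tp_form 1 1)"
    unfolding TP1_def TP2_def TP3_def r_basis_eq e
    by (auto simp: * tp_form_E add.commute)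
qed

lemma tp_classification:
  assumes tp: "transposed_poisson_algebra scale br mul" and nt: "\<not> trivial_product mul"
  shows "\<exists>mul'. transposed_poisson_algebra scale br mul' \<and>
           tp_isomorphic scale br mul scale br mul' \<and>
           (TP1 n e x mul' \<or> TP2 scale n e x mul' \<or>
            (lam = (3 - 2 * of_nat n) / 2 \<and> TP3 scale n e x mul'))"
proof -
  obtain b a where mul: "mul = tp_form b a" using tp_product_form[OF tp] by blast
  have ba: "b \<noteq> 0 \<or> a \<noteq> 0" using nt by (auto simp: mul trivial_product_def tp_form_def)
  consider "b = 0" | "b \<noteq> 0" "lam \<noteq> (3 - 2 * of_nat n) / 2" | "b \<noteq> 0" "a = 0"
    | "b \<noteq> 0" "a \<noteq> 0" "lam = (3 - 2 * of_nat n) / 2" by blast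
  then show ?thesis
  proof cases
    case 1
    then have "a \<noteq> 0" using ba by simp
    \<comment> \<open>With \<open>s = 1\<close>, the parameter \<open>a\<close> becomes
      \<open>a * t^2 = 1\<close>.\<close>
    define t where "t = inverse (csqrt a)"
    have t: "t \<noteq> 0" "0 = b * 1^(2*n-3) * t" "1 = a * 1^(2*n-3) * t^2"
      using 1 \<open>a \<noteq> 0\<close> by (simp_all add: t_def power_inverse)
    from tp_form_diag[OF tp[unfolded mul] one_neq_zero t] show ?thesis
      unfolding mul using tp_form_tables(1) by blast
  next
    case 2
    \<comment> \<open>The shear parameter that makes the new \<open>a\<close> zero;
      \<open>t = inverse b\<close> then normalizes \<open>b\<close> to 1.\<close>
    define c where "c = - a / (b * (3 - 2 * of_nat n - 2 * lam))"
    have "3 - 2 * of_nat n - 2 * lam \<noteq> 0" using 2 by (auto simp: field_simps)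
    then have "0 = a + b * c * (3 - 2 * of_nat n - 2 * lam)" using 2 by (simp add: c_def)
    note shear = tp_form_shear[OF tp[unfolded mul] this]
    have "inverse b \<noteq> 0" "1 = b * 1^(2*n-3) * inverse b" "0 = 0 * 1^(2*n-3) * (inverse b)^2"
      using 2 by simp_all
    note diag = tp_form_diag[OF shear(1) one_neq_zero this]
    from diag(1) tp_isomorphic_trans[OF shear(2) diag(2)] show ?thesis
      unfolding mul using tp_form_tables(2) by blast
  next
    case 3
    then have "inverse b \<noteq> 0" "1 = b * 1^(2*n-3) * inverse b" "0 = a * 1^(2*n-3) * (inverse b)^2"
      by simp_all
    from tp_form_diag[OF tp[unfolded mul] one_neq_zero this] show ?thesis
      unfolding mul using tp_form_tables(2) by blast
  next
    case 4
    \<comment> \<open>Both parameters become 1 when \<open>b * s^(2*n-3) * t = 1\<close> and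
      \<open>a * s^(2*n-3) * t^2 = 1\<close>. Dividing gives \<open>t = b / a\<close>, and
      \<open>s\<close> must be a root of order \<open>2*n-3\<close> of
      \<open>a / b^2\<close>.\<close>
    have *: "a / b^2 \<noteq> 0" "0 < 2*n-3" using 4 n_ge by auto
    have "{z::complex. z^(2*n-3) = a / b^2} \<noteq> {}"
    proof
      assume "{z::complex. z^(2*n-3) = a / b^2} = {}"
      then have "card {z::complex. z^(2*n-3) = a / b^2} = 0" by (simp only: card.empty)
      then show False using card_nth_roots[OF *] *(2) by linarith
    qed
    then obtain s where s: "s^(2*n-3) = a / b^2" by blast
    have "s \<noteq> 0"
    proof
      assume "s = 0"
      then have "s^(2*n-3) = 0" using *(2) by simp
      then show False using s *(1) by (simp only:)
    qed
    moreover have "b / a \<noteq> 0" "1 = b * s^(2*n-3) * (b / a)" "1 = a * s^(2*n-3) * (b / a)^2"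
      unfolding s using 4(1,2) by (simp_all add: field_simps power2_eq_square)
    ultimately have "transposed_poisson_algebra scale br (tp_form 1 1)"
        "tp_isomorphic scale br (tp_form b a) scale br (tp_form 1 1)"
      using tp_form_diag[OF tp[unfolded mul]] by blast+
    then show ?thesis
      unfolding mul using 4(3) tp_form_tables(3) by blast
  qed
qed

end

theorem theorem3p6:
  fixes scale :: "complex \<Rightarrow> 'a::ab_group_add \<Rightarrow> 'a"
    and br mul :: "'a \<Rightarrow> 'a \<Rightarrow> 'a"
    and n :: nat and lam :: complex
    and e :: "nat \<Rightarrow> 'a" and x :: 'a
  assumes "n \<ge> 3"
    and "lam \<noteq> 2 * of_nat n - 3"
    and "lam \<noteq> (5 - 2 * of_nat n) / 2"
    and "r_lie_algebra scale br n lam e x"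
    and "transposed_poisson_algebra scale br mul"
    and "\<not> trivial_product mul"
  shows "\<exists>mul'. transposed_poisson_algebra scale br mul' \<and>
           tp_isomorphic scale br mul scale br mul' \<and>
           (TP1 n e x mul' \<or> TP2 scale n e x mul' \<or>
            (lam = (3 - 2 * of_nat n) / 2 \<and> TP3 scale n e x mul'))"
proof -
  interpret r_lie_algebra_generic scale br n lam e x
    using assms by (intro r_lie_algebra_generic.intro r_lie_algebra_generic_axioms.intro)
  show ?thesis using tp_classification assms(5,6) by blast
qed

end
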